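(* If there is a measurable cardinal $\kappa$, then there are two proper non-maximal filters $F,G$ on a set $D$ of cardinality $\kappa$ such that $F$ dominates $G$, but $$F\cdot G\neq F\boxtimes G\qquad\text{and}\qquad G^d\cdot F^d\neq G^d\boxtimes F^d.$$
   Context: Work in ZFC. Measurable cardinals are uncountable: $\kappa$ is measurable if it is uncountable and carries a nonprincipal $\kappa$-complete ultrafilter. A filter on a nonempty set $D$ is a family $F\subseteq\mathcal P(D)$ that is proper ($\varnothing\notin F$ and $D\in F$), upward monotone ($A\in F$ and $A\subseteq B\subseteq D$ imply $B\in F$), and closed under finite intersections; it is non-maximal if it is not an ultrafilter. For $R\subseteq D^2$ put $R_x=\{y\in D:(x,y)\in R\}$ and $R^{-1}=\{(y,x):(x,y)\in R\}$. For $P,Q\subseteq\mathcal P(D)$, the iteration is $P\cdot Q=\{R\subseteq D^2:\{x\in D:R_x\in Q\}\in P\}$; the branching product is $P\boxtimes Q=\{R\subseteq D^2:\exists A\in P\ \exists B\in Q\ (A\times B\subseteq R)\}$; the dual is $Q^d=\{A\subseteq D:D\setminus A\notin Q\}$. $P$ dominates $Q$ if for every $R\subseteq D^2$, $R\in P\cdot Q$ implies $R^{-1}\in Q\cdot P$. *)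

theory Defs
  imports Main
begin

unbundle cardinal_syntax

text \<open>
  Filters here are families of subsets of an explicit carrier \<open>D\<close>, because the operations below are
  applied to arbitrary families (such as duals of filters). The library type of filters, in contrast,
  lives on a whole type and includes the improper filter.
\<close>

definition filter_on :: "'a set \<Rightarrow> 'a set set \<Rightarrow> bool" where
  "filter_on D F \<longleftrightarrow>
     D \<noteq> {} \<and> F \<subseteq> Pow D \<and> {} \<notin> F \<and> D \<in> F \<and>
     (\<forall>A B. A \<in> F \<and> A \<subseteq> B \<and> B \<subseteq> D \<longrightarrow> B \<in> F) \<and>
     (\<forall>A B. A \<in> F \<and> B \<in> F \<longrightarrow> A \<inter> B \<in> F)"

definition ultrafilter_on :: "'a set \<Rightarrow> 'a set set \<Rightarrow> bool" where
  "ultrafilter_on D F \<longleftrightarrow> filter_on D F \<and> (\<forall>F'. filter_on D F' \<and> F \<subseteq> F' \<longrightarrow> F' = F)"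

lemma ultrafilter_on_iff:
  "ultrafilter_on D F \<longleftrightarrow> filter_on D F \<and> (\<forall>A. A \<subseteq> D \<longrightarrow> A \<in> F \<or> D - A \<in> F)"
proof (intro iffI conjI allI impI)
  assume U: "ultrafilter_on D F"
  then show F: "filter_on D F" by (simp add: ultrafilter_on_def)
  then have D: "D \<noteq> {}" "D \<in> F" and sub: "\<And>C. C \<in> F \<Longrightarrow> C \<subseteq> D"
    and up: "\<And>B C. B \<in> F \<Longrightarrow> B \<subseteq> C \<Longrightarrow> C \<subseteq> D \<Longrightarrow> C \<in> F"
    and int: "\<And>B C. B \<in> F \<Longrightarrow> C \<in> F \<Longrightarrow> B \<inter> C \<in> F"
    unfolding filter_on_def by (simp, simp, blast, metis, simp)
  fix A assume A: "A \<subseteq> D"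
  show "A \<in> F \<or> D - A \<in> F"
  proof (rule disjCI)
    assume nA: "D - A \<notin> F"
    define F' where "F' = {B. B \<subseteq> D \<and> (\<exists>C\<in>F. C \<inter> A \<subseteq> B)}"
    have "filter_on D F'"
      unfolding filter_on_def
    proof (intro conjI allI impI; (elim conjE)?)
      show "D \<noteq> {}" "F' \<subseteq> Pow D" "D \<in> F'" using D A unfolding F'_def by blast+
      show "{} \<notin> F'"
      proof
        assume "{} \<in> F'"
        then obtain C where C: "C \<in> F" "C \<inter> A \<subseteq> {}" unfolding F'_def by blast
        then have "C \<subseteq> D - A" using sub[of C] by blast
        then show False using up[of C "D - A"] C nA by simp
      qed
    next
      fix B1 B2 assume B: "B1 \<in> F'" "B1 \<subseteq> B2" "B2 \<subseteq> D"
      obtain C where C: "C \<in> F" "C \<inter> A \<subseteq> B1" using B(1) unfolding F'_def by blast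
      have "C \<inter> A \<subseteq> B2" using C(2) B(2) by (rule order_trans)
      then show "B2 \<in> F'" using C(1) B(3) unfolding F'_def by blast
    next
      fix B1 B2 assume B: "B1 \<in> F'" "B2 \<in> F'"
      obtain C1 where C1: "C1 \<in> F" "C1 \<inter> A \<subseteq> B1" using B(1) unfolding F'_def by blast
      obtain C2 where C2: "C2 \<in> F" "C2 \<inter> A \<subseteq> B2" using B(2) unfolding F'_def by blast
      have "C1 \<inter> C2 \<in> F" using C1(1) C2(1) by (rule int)
      moreover have "(C1 \<inter> C2) \<inter> A \<subseteq> B1 \<inter> B2" using C1(2) C2(2) by blast
      moreover have "B1 \<inter> B2 \<subseteq> D" using B(1) unfolding F'_def by blast
      ultimately show "B1 \<inter> B2 \<in> F'" unfolding F'_def by blast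
    qed
    moreover have "F \<subseteq> F'" using sub unfolding F'_def by blast
    ultimately have "F' = F" using U by (simp add: ultrafilter_on_def)
    moreover have "A \<in> F'" using A D(2) unfolding F'_def by blast
    ultimately show "A \<in> F" by simp
  qed
next
  assume "filter_on D F \<and> (\<forall>A. A \<subseteq> D \<longrightarrow> A \<in> F \<or> D - A \<in> F)"
  then have F: "filter_on D F" and dec: "\<And>A. A \<subseteq> D \<Longrightarrow> A \<in> F \<or> D - A \<in> F" by auto
  have "F' = F" if F': "filter_on D F'" "F \<subseteq> F'" for F'
  proof (rule antisym[OF subsetI \<open>F \<subseteq> F'\<close>])
    fix A assume A: "A \<in> F'"
    then have "A \<subseteq> D" using F' by (auto simp: filter_on_def)
    moreover have "D - A \<notin> F"
    proof
      assume "D - A \<in> F"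
      then have "D - A \<in> F'" using F' by blast
      then have "A \<inter> (D - A) \<in> F'" using A F'(1) unfolding filter_on_def by metis
      then have "{} \<in> F'" by simp
      then show False using F'(1) by (simp add: filter_on_def)
    qed
    ultimately show "A \<in> F" using dec by metis
  qed
  then show "ultrafilter_on D F" using F by (simp add: ultrafilter_on_def)
qed

definition principal_on :: "'a set \<Rightarrow> 'a set set \<Rightarrow> bool" where
  "principal_on D F \<longleftrightarrow> (\<exists>S. S \<subseteq> D \<and> F = {A. S \<subseteq> A \<and> A \<subseteq> D})"

text \<open>Intersecting with \<open>D\<close> gives the empty intersection the value \<open>D\<close>.\<close>

definition complete_on :: "'b rel \<Rightarrow> 'a set \<Rightarrow> 'a set set \<Rightarrow> bool" where
  "complete_on \<kappa> D F \<longleftrightarrow> (\<forall>\<A>. \<A> \<subseteq> F \<and> |\<A>| <o \<kappa> \<longrightarrow> D \<inter> \<Inter>\<A> \<in> F)"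

text \<open>
  A cardinal is a cardinal order \<open>\<kappa>\<close> on some carrier; its field is a set of cardinality \<open>\<kappa>\<close>.
\<close>

definition measurable_cardinal :: "'a rel \<Rightarrow> bool" where
  "measurable_cardinal \<kappa> \<longleftrightarrow>
     Card_order \<kappa> \<and> natLeq <o \<kappa> \<and>
     (\<exists>U. ultrafilter_on (Field \<kappa>) U \<and> \<not> principal_on (Field \<kappa>) U \<and> complete_on \<kappa> (Field \<kappa>) U)"

definition iteration :: "'a set \<Rightarrow> 'a set set \<Rightarrow> 'a set set \<Rightarrow> 'a rel set" where
  "iteration D P Q = {R. R \<subseteq> D \<times> D \<and> {x \<in> D. {y \<in> D. (x, y) \<in> R} \<in> Q} \<in> P}"

definition branching_product :: "'a set \<Rightarrow> 'a set set \<Rightarrow> 'a set set \<Rightarrow> 'a rel set" where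
  "branching_product D P Q = {R. R \<subseteq> D \<times> D \<and> (\<exists>A\<in>P. \<exists>B\<in>Q. A \<times> B \<subseteq> R)}"

definition dual :: "'a set \<Rightarrow> 'a set set \<Rightarrow> 'a set set" where
  "dual D Q = {A. A \<subseteq> D \<and> D - A \<notin> Q}"

definition dominates :: "'a set \<Rightarrow> 'a set set \<Rightarrow> 'a set set \<Rightarrow> bool" where
  "dominates D P Q \<longleftrightarrow>
     (\<forall>R. R \<subseteq> D \<times> D \<longrightarrow> R \<in> iteration D P Q \<longrightarrow> R\<inverse> \<in> iteration D Q P)"

end

theory Submission
  imports Defs "HOL-Library.Countable_Set"
begin

text \<open>
  Let \<open>U\<close> be a nonprincipal \<open>\<kappa>\<close>-complete ultrafilter on \<open>D\<close>, the field of \<open>\<kappa>\<close>, and let \<open>N \<subseteq> D\<close>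
  be countably infinite. Take for \<open>G\<close> the filter of cocountable subsets of \<open>D\<close>, and let \<open>F\<close> consist
  of the sets in \<open>U\<close> that contain all but finitely many points of \<open>N\<close>.

  The relation \<open>x \<noteq> y\<close> separates \<open>F \<cdot> G\<close> from the branching product: a rectangle inside it has
  disjoint sides, whereas a set in \<open>U\<close> is uncountable and so meets every cocountable set.

  The part of \<open>F\<close> on \<open>N\<close> serves the dual inequality. A set is positive for \<open>G\<close> iff it is
  uncountable, and every infinite subset of \<open>N\<close> is positive for \<open>F\<close>. Assign to uncountably many
  points \<open>y\<close> infinite subsets of \<open>N\<close> that are pairwise almost disjoint. The resulting relation
  belongs to the iteration of the duals. In a rectangle \<open>B \<times> A\<close> inside it, with \<open>B\<close> uncountable, \<open>A\<close>
  is contained in two almost disjoint subsets of \<open>N\<close>, so \<open>A\<close> is a finite subset of \<open>N\<close>; but finite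
  sets are not positive for \<open>F\<close> when \<open>U\<close> is nonprincipal.

  For domination, let each \<open>x\<close> in a set \<open>A \<in> F\<close> have only a countable set of exceptions \<open>y\<close>. The
  exceptions of the points of \<open>N \<inter> A\<close> form a countable set. So do those \<open>y\<close> that are exceptional for
  \<open>U\<close>-many \<open>x\<close>: list the exceptions of every \<open>x\<close> in a sequence; by countable completeness such a
  \<open>y\<close> is the \<open>n\<close>-th exception of \<open>U\<close>-many \<open>x\<close> for some \<open>n\<close>, and \<open>n\<close> determines \<open>y\<close>. For every
  other \<open>y\<close>, the set of \<open>x\<close> that do not have \<open>y\<close> as an exception belongs to \<open>U\<close>, which is an
  ultrafilter, and contains almost all of \<open>N\<close>.
\<close>

section \<open>Ultrafilters closed under countable intersections\<close>

lemma filter_onD: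
  assumes "filter_on D F"
  shows filter_on_empty: "{} \<notin> F"
    and filter_on_subset: "A \<in> F \<Longrightarrow> A \<subseteq> D"
    and filter_on_superset: "A \<in> F \<Longrightarrow> A \<subseteq> B \<Longrightarrow> B \<subseteq> D \<Longrightarrow> B \<in> F"
    and filter_on_Int: "A \<in> F \<Longrightarrow> B \<in> F \<Longrightarrow> A \<inter> B \<in> F"
proof -
  show "{} \<notin> F" "A \<in> F \<Longrightarrow> A \<subseteq> D" "A \<in> F \<Longrightarrow> B \<in> F \<Longrightarrow> A \<inter> B \<in> F"
    using assms by (auto simp: filter_on_def)
  have "\<forall>A B. A \<in> F \<and> A \<subseteq> B \<and> B \<subseteq> D \<longrightarrow> B \<in> F"
    using assms unfolding filter_on_def by (elim conjE)
  then show "A \<in> F \<Longrightarrow> A \<subseteq> B \<Longrightarrow> B \<subseteq> D \<Longrightarrow> B \<in> F" by iprover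
qed

lemma ultrafilter_on_imp_filter_on: "ultrafilter_on D U \<Longrightarrow> filter_on D U"
  by (simp add: ultrafilter_on_def)

lemma ultrafilter_on_Diff_iff:
  assumes "ultrafilter_on D U" "A \<subseteq> D"
  shows "D - A \<in> U \<longleftrightarrow> A \<notin> U"
proof -
  note F = ultrafilter_on_imp_filter_on[OF assms(1)]
  have "\<not> (A \<in> U \<and> D - A \<in> U)"
  proof
    assume "A \<in> U \<and> D - A \<in> U"
    then have "A \<inter> (D - A) \<in> U" using filter_on_Int[OF F] by blast
    then show False using filter_on_empty[OF F] by simp
  qed
  then show ?thesis using assms unfolding ultrafilter_on_iff by blast
qed

text \<open>An ultrafilter containing \<open>{p}\<close> consists of all the sets through \<open>p\<close>, hence is principal.\<close>

lemma singleton_notin_nonprincipal_ultrafilter: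
  assumes U: "ultrafilter_on D U" and np: "\<not> principal_on D U"
  shows "{p} \<notin> U"
proof
  assume p: "{p} \<in> U"
  have F: "filter_on D U" using U by (rule ultrafilter_on_imp_filter_on)
  note ne = filter_on_empty[OF F] and sub = filter_on_subset[OF F]
    and up = filter_on_superset[OF F] and int = filter_on_Int[OF F]
  have "p \<in> A" if "A \<in> U" for A
    using int[OF p that] ne by (cases "p \<in> A") auto
  then have "U = {A. {p} \<subseteq> A \<and> A \<subseteq> D}" using sub up[OF p] by blast
  then show False using np sub[OF p] unfolding principal_on_def by blast
qed

text \<open>Countable completeness in the form in which it is used: large sets are not countable unions of
  small sets.\<close>

lemma countably_complete_ultrafilter_UN:
  fixes A :: "nat \<Rightarrow> 'a set"
  assumes U: "ultrafilter_on D U" and cc: "\<And>A :: nat \<Rightarrow> 'a set. range A \<subseteq> U \<Longrightarrow> D \<inter> \<Inter>(range A) \<in> U"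
    and sub: "\<And>n. A n \<subseteq> D" and large: "(\<Union>n. A n) \<in> U"
  shows "\<exists>n. A n \<in> U"
proof (rule ccontr)
  assume "\<nexists>n. A n \<in> U"
  then have "range (\<lambda>n. D - A n) \<subseteq> U" using ultrafilter_on_Diff_iff[OF U sub] by auto
  then have "D \<inter> (\<Inter>n. D - A n) \<in> U" by (rule cc)
  moreover have "D \<inter> (\<Inter>n. D - A n) = D - (\<Union>n. A n)" by auto
  moreover have "(\<Union>n. A n) \<subseteq> D" using sub by blast
  ultimately show False using ultrafilter_on_Diff_iff[OF U] large by metis
qed

lemma uncountable_of_large:
  assumes U: "ultrafilter_on D U" and np: "\<not> principal_on D U"
    and cc: "\<And>A :: nat \<Rightarrow> 'a set. range A \<subseteq> U \<Longrightarrow> D \<inter> \<Inter>(range A) \<in> U"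
    and A: "A \<in> U"
  shows "uncountable (A :: 'a set)"
proof
  assume c: "countable A"
  have F: "filter_on D U" using U by (rule ultrafilter_on_imp_filter_on)
  have "A \<noteq> {}" "A \<subseteq> D" using filter_on_empty[OF F] filter_on_subset[OF F] A by blast+
  with c obtain a :: "nat \<Rightarrow> 'a" where a: "range a = A" by (metis range_from_nat_into)
  have "(\<Union>n. {a n}) = A" using a by auto
  then have "\<exists>n. {a n} \<in> U"
    using a A \<open>A \<subseteq> D\<close> by (intro countably_complete_ultrafilter_UN[OF U cc]) auto
  then show False using singleton_notin_nonprincipal_ultrafilter[OF U np] by blast
qed

text \<open>The combinatorial core of domination. If \<open>s x\<close> is listed as \<open>e x 0, e x 1, \<dots>\<close>, then a point \<open>y\<close>
  that lies in \<open>s x\<close> for \<open>U\<close>-many \<open>x\<close> is \<open>e x n\<close> for \<open>U\<close>-many \<open>x\<close> and some \<open>n\<close>. Two points cannot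
  share the same \<open>n\<close>, because two sets of \<open>U\<close> intersect.\<close>

lemma countable_frequent_points:
  fixes s :: "'a \<Rightarrow> 'b set"
  assumes U: "ultrafilter_on D U"
    and cc: "\<And>A :: nat \<Rightarrow> 'a set. range A \<subseteq> U \<Longrightarrow> D \<inter> \<Inter>(range A) \<in> U"
    and A: "A \<in> U" and s: "\<And>x. x \<in> A \<Longrightarrow> countable (s x)"
  shows "countable {y. {x \<in> D. y \<in> s x} \<in> U}" (is "countable ?T")
proof -
  have F: "filter_on D U" using U by (rule ultrafilter_on_imp_filter_on)
  note ne = filter_on_empty[OF F] and AD = filter_on_subset[OF F A]
    and up = filter_on_superset[OF F] and int = filter_on_Int[OF F]
  define e where "e x = from_nat_into (s x)" for x
  have "\<exists>n. {x \<in> A. e x n = y} \<in> U" if "y \<in> ?T" for y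
  proof (rule countably_complete_ultrafilter_UN[OF U cc])
    have "A \<inter> {x \<in> D. y \<in> s x} \<in> U" using int[OF A] that by blast
    moreover have "A \<inter> {x \<in> D. y \<in> s x} \<subseteq> (\<Union>n. {x \<in> A. e x n = y})"
      using s from_nat_into_surj unfolding e_def by fastforce
    ultimately show "(\<Union>n. {x \<in> A. e x n = y}) \<in> U" by (rule up) (use AD in blast)
  qed (use AD in auto)
  then have "\<exists>n. \<forall>y\<in>?T. {x \<in> A. e x (n y) = y} \<in> U" by (intro bchoice ballI)
  then obtain n where n: "\<And>y. y \<in> ?T \<Longrightarrow> {x \<in> A. e x (n y) = y} \<in> U" by blast
  have "inj_on n ?T"
  proof (rule inj_onI)
    fix y z assume yz: "y \<in> ?T" "z \<in> ?T" "n y = n z"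
    have "{x \<in> A. e x (n y) = y} \<inter> {x \<in> A. e x (n z) = z} \<noteq> {}"
      using int[OF n[OF yz(1)] n[OF yz(2)]] ne by metis
    then show "y = z" using yz(3) by auto
  qed
  then show ?thesis by (rule countableI)
qed

section \<open>Two families of filters\<close>

definition cocountable :: "'a set \<Rightarrow> 'a set set" where
  "cocountable D = {A. A \<subseteq> D \<and> countable (D - A)}"

text \<open>The intersection of \<open>U\<close> with the filter of all sets that contain almost all of \<open>N\<close>.\<close>

definition cofinite_part :: "'a set \<Rightarrow> 'a set set \<Rightarrow> 'a set set" where
  "cofinite_part N U = {A \<in> U. finite (N - A)}"

text \<open>Two disjoint copies of \<open>D\<close> in \<open>D\<close>, or of \<open>N\<close> in \<open>N\<close>, show that the filters defined above are
  not maximal: neither the first copy nor its complement is large.\<close>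

lemma infinite_imp_two_disjoint_copies:
  assumes "infinite X"
  obtains f g where "inj_on f X" "inj_on g X" "f ` X \<subseteq> X" "g ` X \<subseteq> X" "f ` X \<inter> g ` X = {}"
proof -
  have "|X <+> X| =o |X|" using assms by (rule card_of_Plus_infinite1) (rule card_of_refl[THEN ordIso_iff_ordLeq[THEN iffD1], THEN conjunct1])
  then obtain h where "bij_betw h (X <+> X) X" using card_of_ordIso by blast
  then have h: "inj_on h (X <+> X)" "h ` (X <+> X) = X" by (auto simp: bij_betw_def)
  show thesis
  proof (rule that[of "h \<circ> Inl" "h \<circ> Inr"])
    show "inj_on (h \<circ> Inl) X" "inj_on (h \<circ> Inr) X"
      using h(1) by (auto simp: inj_on_def)
    show "(h \<circ> Inl) ` X \<subseteq> X" "(h \<circ> Inr) ` X \<subseteq> X" using h(2) by auto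
    show "(h \<circ> Inl) ` X \<inter> (h \<circ> Inr) ` X = {}" using h(1) by (fastforce simp: inj_on_def)
  qed
qed

lemma filter_on_cocountable:
  assumes "uncountable D"
  shows "filter_on D (cocountable D)"
  unfolding filter_on_def
proof (intro conjI allI impI; (elim conjE)?)
  show "D \<noteq> {}" using assms by auto
  show "cocountable D \<subseteq> Pow D" "{} \<notin> cocountable D" "D \<in> cocountable D"
    using assms by (auto simp: cocountable_def)
next
  fix A B assume A: "A \<in> cocountable D" "A \<subseteq> B" "B \<subseteq> D"
  then have "D - B \<subseteq> D - A" by blast
  then show "B \<in> cocountable D" using A by (auto simp: cocountable_def intro: countable_subset)
next
  fix A B assume "A \<in> cocountable D" "B \<in> cocountable D"
  then show "A \<inter> B \<in> cocountable D" by (auto simp: cocountable_def Diff_Int)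
qed

lemma not_ultrafilter_on_cocountable:
  assumes "uncountable D"
  shows "\<not> ultrafilter_on D (cocountable D)"
proof
  assume U: "ultrafilter_on D (cocountable D)"
  have "infinite D" using assms countable_finite by blast
  then obtain f g where fg: "inj_on f D" "inj_on g D" "f ` D \<subseteq> D" "g ` D \<subseteq> D" "f ` D \<inter> g ` D = {}"
    by (rule infinite_imp_two_disjoint_copies)
  have unc: "uncountable (f ` D)" "uncountable (g ` D)"
    using assms fg(1,2) countable_image_inj_on by blast+
  have "f ` D \<in> cocountable D \<or> D - f ` D \<in> cocountable D"
    using U fg(3) unfolding ultrafilter_on_iff by blast
  then have "countable (D - f ` D) \<or> countable (f ` D)"
    using fg(3) by (auto simp: cocountable_def double_diff)
  moreover have "g ` D \<subseteq> D - f ` D" using fg(4,5) by blast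
  ultimately show False using unc countable_subset[of \<open>g ` D\<close> \<open>D - f ` D\<close>] by metis
qed

lemma filter_on_cofinite_part:
  assumes "filter_on D U" "N \<subseteq> D"
  shows "filter_on D (cofinite_part N U)"
  unfolding filter_on_def
proof (intro conjI allI impI; (elim conjE)?)
  show "D \<noteq> {}" "cofinite_part N U \<subseteq> Pow D" "{} \<notin> cofinite_part N U" "D \<in> cofinite_part N U"
    using assms by (auto simp: filter_on_def cofinite_part_def Diff_eq_empty_iff[THEN iffD2])
next
  fix A B assume A: "A \<in> cofinite_part N U" "A \<subseteq> B" "B \<subseteq> D"
  then have "B \<in> U" using filter_on_superset[OF assms(1)] by (auto simp: cofinite_part_def)
  moreover have "N - B \<subseteq> N - A" using A by blast
  ultimately show "B \<in> cofinite_part N U"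
    using A by (auto simp: cofinite_part_def intro: finite_subset)
next
  fix A B assume "A \<in> cofinite_part N U" "B \<in> cofinite_part N U"
  then show "A \<inter> B \<in> cofinite_part N U"
    using assms(1) by (auto simp: cofinite_part_def filter_on_def Diff_Int)
qed

lemma not_ultrafilter_on_cofinite_part:
  assumes "infinite N" "N \<subseteq> D"
  shows "\<not> ultrafilter_on D (cofinite_part N U)"
proof
  assume U: "ultrafilter_on D (cofinite_part N U)"
  obtain f g where fg: "inj_on f N" "inj_on g N" "f ` N \<subseteq> N" "g ` N \<subseteq> N" "f ` N \<inter> g ` N = {}"
    using assms(1) by (rule infinite_imp_two_disjoint_copies)
  have inf: "infinite (f ` N)" "infinite (g ` N)"
    using assms(1) fg(1,2) finite_imageD by blast+
  have "f ` N \<in> cofinite_part N U \<or> D - f ` N \<in> cofinite_part N U"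
    using U fg(3) assms(2) unfolding ultrafilter_on_iff by blast
  then have "finite (N - f ` N) \<or> finite (N - (D - f ` N))" by (auto simp: cofinite_part_def)
  moreover have "g ` N \<subseteq> N - f ` N" "f ` N \<subseteq> N - (D - f ` N)" using fg(3,4,5) by blast+
  ultimately show False using inf finite_subset[of \<open>g ` N\<close>] finite_subset[of \<open>f ` N\<close>] by meson
qed

section \<open>Domination\<close>

text \<open>Outside the countable set \<open>Z\<close> of bad points \<open>y\<close>, the points \<open>x\<close> related to \<open>y\<close> are \<open>U\<close>-many and
  include \<open>N \<inter> A\<close>. The countability of \<open>N\<close> keeps \<open>Z\<close> countable.\<close>

lemma dominates_cofinite_part_cocountable:
  fixes D :: "'a set"
  assumes U: "ultrafilter_on D U"
    and cc: "\<And>A :: nat \<Rightarrow> 'a set. range A \<subseteq> U \<Longrightarrow> D \<inter> \<Inter>(range A) \<in> U"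
    and N: "countable N" "N \<subseteq> D"
  shows "dominates D (cofinite_part N U) (cocountable D)"
  unfolding dominates_def
proof (intro allI impI)
  fix R assume R: "R \<subseteq> D \<times> D" "R \<in> iteration D (cofinite_part N U) (cocountable D)"
  define s where "s x = {y \<in> D. (x, y) \<notin> R}" for x
  define A where "A = {x \<in> D. countable (s x)}"
  have "{x \<in> D. {y \<in> D. (x, y) \<in> R} \<in> cocountable D} = A"
  proof -
    have "D - {y \<in> D. (x, y) \<in> R} = s x" for x by (auto simp: s_def)
    then show ?thesis by (auto simp: A_def cocountable_def)
  qed
  then have A: "A \<in> U" "finite (N - A)"
    using R(2) by (auto simp: iteration_def cofinite_part_def)
  define Z where "Z = {y. {x \<in> D. y \<in> s x} \<in> U} \<union> (\<Union>x\<in>N \<inter> A. s x)"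
  have "countable {y. {x \<in> D. y \<in> s x} \<in> U}"
    by (rule countable_frequent_points[OF U cc A(1)]) (auto simp: A_def)
  then have Z: "countable Z" using N(1) by (auto simp: Z_def A_def)
  have "{x \<in> D. (y, x) \<in> R\<inverse>} \<in> cofinite_part N U" if y: "y \<in> D - Z" for y
  proof -
    have "{x \<in> D. y \<in> s x} \<notin> U" using y by (auto simp: Z_def)
    then have "D - {x \<in> D. y \<in> s x} \<in> U" using ultrafilter_on_Diff_iff[OF U] by auto
    moreover have "D - {x \<in> D. y \<in> s x} = {x \<in> D. (y, x) \<in> R\<inverse>}" using y by (auto simp: s_def)
    moreover have "N - {x \<in> D. (y, x) \<in> R\<inverse>} \<subseteq> N - A" using y N(2) by (auto simp: Z_def s_def)
    ultimately show ?thesis using A(2) by (auto simp: cofinite_part_def intro: finite_subset)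
  qed
  then have "D - {y \<in> D. {x \<in> D. (y, x) \<in> R\<inverse>} \<in> cofinite_part N U} \<subseteq> Z" by blast
  then have "{y \<in> D. {x \<in> D. (y, x) \<in> R\<inverse>} \<in> cofinite_part N U} \<in> cocountable D"
    using Z by (auto simp: cocountable_def intro: countable_subset)
  then show "R\<inverse> \<in> iteration D (cocountable D) (cofinite_part N U)"
    using R(1) by (auto simp: iteration_def)
qed

section \<open>The two inequalities\<close>

text \<open>The relation \<open>x \<noteq> y\<close> contains no rectangle with one side uncountable and the other
  cocountable, because the two sides would meet.\<close>

lemma iteration_cocountable_neq_branching_product:
  assumes F: "filter_on D F" and unc: "\<And>A. A \<in> F \<Longrightarrow> uncountable A"
  shows "iteration D F (cocountable D) \<noteq> branching_product D F (cocountable D)"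
proof -
  define R where "R = {(x, y) \<in> D \<times> D. x \<noteq> y}"
  have "{y \<in> D. (x, y) \<in> R} \<in> cocountable D" if "x \<in> D" for x
  proof -
    have "D - {y \<in> D. (x, y) \<in> R} = {x}" using that by (auto simp: R_def)
    then show ?thesis by (auto simp: cocountable_def)
  qed
  then have "{x \<in> D. {y \<in> D. (x, y) \<in> R} \<in> cocountable D} = D" by blast
  then have "R \<in> iteration D F (cocountable D)"
    using F by (auto simp: iteration_def filter_on_def R_def)
  moreover have "R \<notin> branching_product D F (cocountable D)"
  proof
    assume "R \<in> branching_product D F (cocountable D)"
    then obtain A B where AB: "A \<in> F" "B \<in> cocountable D" "A \<times> B \<subseteq> R"
      by (auto simp: branching_product_def)
    then have "A \<subseteq> D" using F by (auto simp: filter_on_def)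
    then have "A \<subseteq> D - B" using AB(3) by (auto simp: R_def)
    then have "countable A" using AB(2) by (auto simp: cocountable_def intro: countable_subset)
    then show False using unc AB(1) by blast
  qed
  ultimately show ?thesis by blast
qed

text \<open>The finite initial segments of distinct infinite binary sequences form almost disjoint sets:
  beyond the first difference, the sequences have no segment in common.\<close>

lemma almost_disjoint_family:
  obtains f :: "nat set \<Rightarrow> nat set"
  where "\<And>b. infinite (f b)" "\<And>b c. b \<noteq> c \<Longrightarrow> finite (f b \<inter> f c)"
proof -
  define seg where "seg b n = map (\<lambda>i. i \<in> b) [0..<n]" for b :: "nat set" and n
  have len: "length (seg b n) = n" for b n by (simp add: seg_def)
  define f where "f b = to_nat ` range (seg b)" for b
  have "infinite (f b)" for b
  proof -
    have "inj (\<lambda>n. to_nat (seg b n))" by (rule injI) (metis len from_nat_to_nat)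
    moreover have "f b = range (\<lambda>n. to_nat (seg b n))" by (auto simp: f_def)
    ultimately show ?thesis using range_inj_infinite by metis
  qed
  moreover have "finite (f b \<inter> f c)" if bc: "b \<noteq> c" for b c
  proof -
    obtain k where k: "k \<in> b \<longleftrightarrow> k \<notin> c" using bc by blast
    have "f b \<inter> f c \<subseteq> (\<lambda>n. to_nat (seg b n)) ` {..k}"
    proof
      fix m assume "m \<in> f b \<inter> f c"
      then obtain n n' where m: "m = to_nat (seg b n)" "m = to_nat (seg c n')"
        unfolding f_def by blast
      then have "seg b n = seg c n'" by simp
      moreover from this have "n = n'" by (metis len)
      ultimately have seg: "seg b n = seg c n" by simp
      have "n \<le> k"
      proof (rule ccontr)
        assume "\<not> n \<le> k"
        then have "seg b n ! k = (k \<in> b)" "seg c n ! k = (k \<in> c)" by (simp_all add: seg_def)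
        then show False using seg k by simp
      qed
      then show "m \<in> (\<lambda>n. to_nat (seg b n)) ` {..k}" using m(1) by blast
    qed
    then show ?thesis by (rule finite_subset) simp
  qed
  ultimately show thesis by (rule that)
qed

text \<open>Comparing \<open>D\<close> with the continuum lets the indices of an almost disjoint family be chosen in \<open>D\<close>:
  the smaller of the two embeds into the other, and both are uncountable.\<close>

lemma almost_disjoint_family_on:
  assumes D: "uncountable D" and N: "infinite N"
  obtains Y f where "Y \<subseteq> D" "uncountable Y" "\<And>y. y \<in> Y \<Longrightarrow> f y \<subseteq> N \<and> infinite (f y)"
    "\<And>y z. y \<in> Y \<Longrightarrow> z \<in> Y \<Longrightarrow> y \<noteq> z \<Longrightarrow> finite (f y \<inter> f z)"
proof -
  obtain a :: "nat set \<Rightarrow> nat set"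
    where a: "\<And>b. infinite (a b)" "\<And>b c. b \<noteq> c \<Longrightarrow> finite (a b \<inter> a c)"
    using almost_disjoint_family by metis
  obtain e :: "nat \<Rightarrow> _" where e: "inj e" "range e \<subseteq> N"
    using infinite_countable_subset[OF N] by blast
  have cantor: "uncountable (UNIV :: nat set set)"
  proof
    assume "countable (UNIV :: nat set set)"
    then have "range (from_nat_into (UNIV :: nat set set)) = UNIV"
      by (intro range_from_nat_into) auto
    then show False using Cantors_theorem by (metis Pow_UNIV)
  qed
  have "\<exists>Y (h :: _ \<Rightarrow> nat set). Y \<subseteq> D \<and> uncountable Y \<and> inj_on h Y"
  proof (cases "|D| \<le>o |UNIV :: nat set set|")
    case True
    then obtain h :: "_ \<Rightarrow> nat set" where "inj_on h D" using card_of_ordLeq by metis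
    then show ?thesis using D by blast
  next
    case False
    then have "|UNIV :: nat set set| \<le>o |D|" using ordLeq_total by (metis card_of_Well_order)
    then obtain g :: "nat set \<Rightarrow> _" where g: "inj g" "range g \<subseteq> D" using card_of_ordLeq by metis
    have "uncountable (range g)" using cantor g(1) countable_image_inj_on by blast
    moreover have "inj_on (inv g) (range g)" by (rule inj_on_inv_into) simp
    ultimately show ?thesis using g(2) by blast
  qed
  then obtain Y and h :: "_ \<Rightarrow> nat set" where Y: "Y \<subseteq> D" "uncountable Y" "inj_on h Y" by blast
  show thesis
  proof (rule that[of Y "\<lambda>y. e ` a (h y)"])
    show "e ` a (h y) \<subseteq> N \<and> infinite (e ` a (h y))" for y
      using e a(1)[of "h y"] by (auto simp: finite_image_iff inj_on_def)
    show "finite (e ` a (h y) \<inter> e ` a (h z))" if "y \<in> Y" "z \<in> Y" "y \<noteq> z" for y z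
    proof -
      have "h y \<noteq> h z" using Y(3) that by (auto dest: inj_onD)
      then show ?thesis using a(2) e(1) by (simp flip: image_Int)
    qed
  qed (use Y in auto)
qed

text \<open>The witness is the relation between \<open>y\<close> and the points of the \<open>y\<close>-th member of an almost
  disjoint family of subsets of \<open>N\<close>. Two distinct points on the uncountable side of a rectangle
  suffice to make the other side finite.\<close>

lemma iteration_duals_neq_branching_product:
  assumes D: "uncountable D" and N: "infinite N" "N \<subseteq> D"
    and U: "ultrafilter_on D U" and fin: "\<And>A. finite A \<Longrightarrow> A \<notin> U"
  shows "iteration D (dual D (cocountable D)) (dual D (cofinite_part N U)) \<noteq>
    branching_product D (dual D (cocountable D)) (dual D (cofinite_part N U))"
proof -
  have G: "B \<in> dual D (cocountable D) \<longleftrightarrow> B \<subseteq> D \<and> uncountable B" for B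
    by (auto simp: dual_def cocountable_def double_diff)
  obtain Y f where Y: "Y \<subseteq> D" "uncountable Y" and f: "\<And>y. y \<in> Y \<Longrightarrow> f y \<subseteq> N \<and> infinite (f y)"
    and ad: "\<And>y z. y \<in> Y \<Longrightarrow> z \<in> Y \<Longrightarrow> y \<noteq> z \<Longrightarrow> finite (f y \<inter> f z)"
    using almost_disjoint_family_on[OF D N(1)] by metis
  define S where "S = (SIGMA y:Y. f y)"
  have S: "S \<subseteq> D \<times> D" using Y(1) f N(2) by (auto simp: S_def)
  have "{x \<in> D. (y, x) \<in> S} \<in> dual D (cofinite_part N U)" if y: "y \<in> Y" for y
  proof -
    have "{x \<in> D. (y, x) \<in> S} = f y" using y f N(2) by (auto simp: S_def)
    moreover have "f y \<subseteq> N - (D - f y)" using f y by blast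
    then have "infinite (N - (D - f y))" using f y finite_subset by blast
    ultimately show ?thesis by (auto simp: dual_def cofinite_part_def)
  qed
  then have "Y \<subseteq> {y \<in> D. {x \<in> D. (y, x) \<in> S} \<in> dual D (cofinite_part N U)}"
    using Y(1) by blast
  then have "uncountable {y \<in> D. {x \<in> D. (y, x) \<in> S} \<in> dual D (cofinite_part N U)}"
    using Y(2) countable_subset by blast
  then have "S \<in> iteration D (dual D (cocountable D)) (dual D (cofinite_part N U))"
    using S by (auto simp: iteration_def G)
  moreover have "S \<notin> branching_product D (dual D (cocountable D)) (dual D (cofinite_part N U))"
  proof
    assume "S \<in> branching_product D (dual D (cocountable D)) (dual D (cofinite_part N U))"
    then obtain B A where B: "uncountable B" and A: "A \<in> dual D (cofinite_part N U)"
      and BA: "B \<times> A \<subseteq> S"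
      by (auto simp: branching_product_def G)
    have "infinite A"
    proof
      assume finA: "finite A"
      have "A \<subseteq> D" using A by (simp add: dual_def)
      then have "D - A \<in> U" using fin[OF finA] ultrafilter_on_Diff_iff[OF U] by blast
      moreover have "finite (N - (D - A))"
        using finA N(2) by (auto intro: finite_subset[of _ A])
      ultimately show False using A by (simp add: dual_def cofinite_part_def)
    qed
    obtain y where y: "y \<in> B" using B by (metis countable_empty ex_in_conv)
    obtain z where z: "z \<in> B" "z \<noteq> y" using B
      by (metis countable_finite finite.emptyI finite.insertI finite_subset insertI1 subsetI)
    have "A \<noteq> {}" using \<open>infinite A\<close> by auto
    then have "y \<in> Y" "z \<in> Y" "A \<subseteq> f y \<inter> f z" using BA y z by (auto simp: S_def)
    then show False using ad z(2) \<open>infinite A\<close> finite_subset by metis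
  qed
  ultimately show ?thesis by blast
qed

section \<open>Filters on a measurable cardinal\<close>

theorem theorem8p3:
  fixes \<kappa> :: "'a rel"
  assumes "measurable_cardinal \<kappa>"
  shows "\<exists>(D :: 'a set) F G.
           |D| =o \<kappa> \<and>
           filter_on D F \<and> \<not> ultrafilter_on D F \<and>
           filter_on D G \<and> \<not> ultrafilter_on D G \<and>
           dominates D F G \<and>
           iteration D F G \<noteq> branching_product D F G \<and>
           iteration D (dual D G) (dual D F) \<noteq> branching_product D (dual D G) (dual D F)"
proof -
  define D where "D = Field \<kappa>"
  have \<kappa>: "Card_order \<kappa>" "natLeq <o \<kappa>"
    using assms by (simp_all only: measurable_cardinal_def)
  obtain U where U: "ultrafilter_on D U" "\<not> principal_on D U" and compl: "complete_on \<kappa> D U"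
    using assms by (auto simp only: measurable_cardinal_def D_def)
  have card: "|D| =o \<kappa>" unfolding D_def using \<kappa>(1) by (rule card_of_Field_ordIso)
  have cc: "D \<inter> \<Inter>(range A) \<in> U" if A: "range A \<subseteq> U" for A :: "nat \<Rightarrow> 'a set"
  proof -
    have "|range A| \<le>o |UNIV :: nat set|" by (rule card_of_image)
    then have "|range A| \<le>o natLeq" using card_of_nat by (rule ordLeq_ordIso_trans)
    then have "|range A| <o \<kappa>" using \<kappa>(2) by (rule ordLeq_ordLess_trans)
    then show ?thesis using compl A unfolding complete_on_def by blast
  qed
  have D: "uncountable D"
  proof
    assume "countable D"
    then obtain h :: "'a \<Rightarrow> nat" where "inj_on h D" by (rule countableE)
    then have "|D| \<le>o |UNIV :: nat set|" by (intro card_of_ordLeqI) auto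
    then have "|D| \<le>o natLeq" using card_of_nat by (rule ordLeq_ordIso_trans)
    with ordIso_symmetric[OF card] have "\<kappa> \<le>o natLeq" by (rule ordIso_ordLeq_trans)
    then show False using not_ordLess_ordLeq[OF \<kappa>(2)] by contradiction
  qed
  have unc: "uncountable A" if "A \<in> U" for A
    using U cc that by (rule uncountable_of_large)
  have "infinite D" using D countable_finite by blast
  then obtain N where N: "N \<subseteq> D" "infinite N" "countable N" using infinite_countable_subset' by blast
  let ?F = "cofinite_part N U" and ?G = "cocountable D"
  have F: "filter_on D ?F"
    using ultrafilter_on_imp_filter_on[OF U(1)] N(1) by (rule filter_on_cofinite_part)
  have "dominates D ?F ?G"
    using U(1) cc N(3,1) by (rule dominates_cofinite_part_cocountable)
  moreover have "iteration D ?F ?G \<noteq> branching_product D ?F ?G"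
    by (rule iteration_cocountable_neq_branching_product[OF F])
      (use unc in \<open>auto simp: cofinite_part_def\<close>)
  moreover have "iteration D (dual D ?G) (dual D ?F) \<noteq> branching_product D (dual D ?G) (dual D ?F)"
    by (rule iteration_duals_neq_branching_product[OF D N(2,1) U(1)])
      (use unc countable_finite in blast)
  ultimately show ?thesis
    using card F not_ultrafilter_on_cofinite_part[OF N(2,1)] filter_on_cocountable[OF D]
      not_ultrafilter_on_cocountable[OF D]
    by (intro exI[of _ D] exI[of _ ?F] exI[of _ ?G] conjI)
qed

end
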